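(* Let $\varepsilon>0$. Then the proportion of sequences $A \in \mathcal{B}_n$ satisfying $$\mu(A) > \sqrt{2n\big(\log n - (1-\varepsilon)\log\log n\big)}$$ approaches $0$ as $n$ approaches infinity.
   Context: A binary sequence of length $n$ is an $n$-tuple $A = (a_0, a_1, \ldots, a_{n-1})$ with each $a_j \in \{+1,-1\}$. $\mathcal{B}_n$ denotes the set of all $2^n$ binary sequences of length $n$. For $0 \le k \le n-1$, the (aperiodic) autocorrelations of $A$ are $c_k = \sum_{j=0}^{n-k-1} a_j a_{j+k}$. For $n \ge 2$, the peak sidelobe level of $A$ is $\mu(A) = \max_{1\le k\le n-1} |c_k|$. The proportion of sequences $A \in \mathcal{B}_n$ with a given property is the number of such sequences divided by $2^n$. Here $\log$ denotes the natural logarithm. *)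

theory Defs
  imports Complex_Main
begin

definition binary_sequences :: "nat \<Rightarrow> int list set" where
  "binary_sequences n = {A. length A = n \<and> set A \<subseteq> {1, -1}}"

definition autocorrelation :: "int list \<Rightarrow> nat \<Rightarrow> int" where
  "autocorrelation A k = (\<Sum>j<length A - k. A ! j * A ! (j + k))"

(* Meaningful for length A >= 2 only; for shorter lists Max is applied to the empty set. *)
definition peak_sidelobe_level :: "int list \<Rightarrow> int" where
  "peak_sidelobe_level A = Max ((\<lambda>k. \<bar>autocorrelation A k\<bar>) ` {1..length A - 1})"

definition proportion :: "nat \<Rightarrow> (int list \<Rightarrow> bool) \<Rightarrow> real" where
  "proportion n P = real (card {A \<in> binary_sequences n. P A}) / 2 ^ n"

end

theory Submission
  imports Defs "HOL-Real_Asymp.Real_Asymp"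
begin

text \<open>
  The proof is a Chernoff bound for each autocorrelation followed by a union bound over
  the shifts.  Read a sequence from left to right: for a fixed shift \<open>k \<ge> 1\<close>, each new
  entry \<open>x = \<plusminus>1\<close> after the first \<open>k\<close> adds the term \<open>y * x\<close> to \<open>c\<^sub>k\<close>, where \<open>y = \<plusminus>1\<close> is an entry already
  read.  As \<open>x\<close> takes both values, so does \<open>y * x\<close>, whatever \<open>y\<close> is; hence \<open>c\<^sub>k\<close> is
  distributed exactly like a sum of \<open>n - k\<close> independent signs, and its moment generating
  function is \<open>(cosh u) ^ (n - k)\<close> (\<open>sum_exp_autocorrelation\<close>).  With
  \<open>cosh u \<le> exp (u\<^sup>2 / 2)\<close> this gives the Gaussian tail
  \<open>2 * exp (- t\<^sup>2 / (2 * (n - k)))\<close> for \<open>\<bar>c\<^sub>k\<bar> > t\<close>.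

  Put \<open>t\<^sup>2 = 2 * n * L\<close> with \<open>L = ln n - (1 - \<epsilon>) * ln (ln n)\<close>.  Bounding the tails for all
  \<open>k\<close> by the one for \<open>k = 0\<close> would only give
  \<open>2 * n * exp (- L) = 2 * (ln n) powr (1 - \<epsilon>)\<close>, which does not tend to \<open>0\<close> if
  \<open>\<epsilon> \<le> 1\<close>.  The missing factor comes from the shorter sums: since
  \<open>n / (n - k) \<ge> 1 + k / n\<close>, the tail at shift \<open>k\<close> is at most
  \<open>2 * exp (- L) * exp (- L / n) ^ k\<close>, and the geometric series over \<open>k\<close> sums to at most
  \<open>n / L\<close> instead of \<open>n\<close> (\<open>proportion_peak_sidelobe_level\<close>).  So the proportion is at most
  \<open>2 * exp (- L) * n / L\<close>, which is asymptotic to \<open>2 * (ln n) powr (- \<epsilon>)\<close>.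
\<close>

section \<open>The moment generating function of an autocorrelation\<close>

lemma binary_sequences_Suc:
  "binary_sequences (Suc n) = (\<lambda>(A, x). A @ [x]) ` (binary_sequences n \<times> {1, -1})"
proof (intro equalityI subsetI)
  fix B assume B: "B \<in> binary_sequences (Suc n)"
  then have "B \<noteq> []"
    by (auto simp: binary_sequences_def)
  then have eq: "B = butlast B @ [last B]"
    by simp
  have "butlast B \<in> binary_sequences n" "last B \<in> {1, -1}"
    using B \<open>B \<noteq> []\<close> last_in_set[of B]
    by (auto simp: binary_sequences_def subset_iff dest: in_set_butlastD)
  then show "B \<in> (\<lambda>(A, x). A @ [x]) ` (binary_sequences n \<times> {1, -1})"
    using eq by (intro image_eqI[where x = "(butlast B, last B)"]) auto
qed (auto simp: binary_sequences_def)

lemma sum_binary_sequences_Suc: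
  fixes f :: "int list \<Rightarrow> 'b::comm_monoid_add"
  shows "sum f (binary_sequences (Suc n)) =
           (\<Sum>A\<in>binary_sequences n. f (A @ [1]) + f (A @ [-1]))"
proof -
  have "inj_on (\<lambda>(A, x). A @ [x]) (binary_sequences n \<times> {1, -1::int})"
    by (auto simp: inj_on_def)
  then have "sum f (binary_sequences (Suc n)) =
      (\<Sum>(A, x)\<in>binary_sequences n \<times> {1, -1}. f (A @ [x]))"
    unfolding binary_sequences_Suc by (subst sum.reindex) (auto simp: case_prod_beta)
  also have "\<dots> = (\<Sum>A\<in>binary_sequences n. \<Sum>x\<in>{1, -1}. f (A @ [x]))"
    by (rule sum.cartesian_product [symmetric])
  also have "\<dots> = (\<Sum>A\<in>binary_sequences n. f (A @ [1]) + f (A @ [-1]))"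
    by simp
  finally show ?thesis .
qed

lemma binary_sequences_0: "binary_sequences 0 = {[]}"
  by (auto simp: binary_sequences_def)

lemma finite_binary_sequences: "finite (binary_sequences n)"
  by (induction n) (simp_all add: binary_sequences_0 binary_sequences_Suc)

lemma autocorrelation_snoc:
  assumes "1 \<le> k" "k \<le> length A"
  shows "autocorrelation (A @ [x]) k = autocorrelation A k + A ! (length A - k) * x"
proof -
  have "length A - k < length A"
    using assms by simp
  then have "autocorrelation (A @ [x]) k =
      (\<Sum>j<length A - k. (A @ [x]) ! j * (A @ [x]) ! (j + k)) + A ! (length A - k) * x"
    using assms by (simp add: autocorrelation_def Suc_diff_le nth_append)
  also have "(\<Sum>j<length A - k. (A @ [x]) ! j * (A @ [x]) ! (j + k)) = autocorrelation A k"
    unfolding autocorrelation_def by (rule sum.cong) (auto simp: nth_append)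
  finally show ?thesis .
qed

text \<open>
  The two extensions of a sequence change \<open>c\<^sub>k\<close> by \<open>1\<close> and by \<open>- 1\<close>, in an order that
  depends on the sequence; their contributions add up to the factor
  \<open>exp u + exp (- u)\<close> in either order.  Only the first \<open>k\<close> entries do not contribute to
  \<open>c\<^sub>k\<close>; truncated subtraction makes the formula correct for \<open>n \<le> k\<close> too.
\<close>

lemma sum_exp_autocorrelation:
  fixes u :: real
  assumes "1 \<le> k"
  shows "(\<Sum>A\<in>binary_sequences n. exp (u * real_of_int (autocorrelation A k))) =
           2 ^ n * cosh u ^ (n - k)"
proof (induction n)
  case 0
  show ?case
    by (simp add: binary_sequences_0 autocorrelation_def)
next
  case (Suc n)
  let ?E = "\<lambda>A. exp (u * real_of_int (autocorrelation A k))"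
  have step: "?E (A @ [1]) + ?E (A @ [-1]) = 2 * cosh u ^ (Suc n - k - (n - k)) * ?E A"
    if A: "A \<in> binary_sequences n" for A
  proof (cases "k \<le> n")
    case True
    have len: "length A = n"
      using A by (simp add: binary_sequences_def)
    then have "A ! (n - k) \<in> set A"
      using True assms by (intro nth_mem) simp
    then have "A ! (n - k) = 1 \<or> A ! (n - k) = -1"
      using A by (auto simp: binary_sequences_def)
    then show ?thesis
      using True assms len
      by (auto simp: autocorrelation_snoc Suc_diff_le cosh_field_def algebra_simps
          exp_add exp_diff exp_minus divide_simps)
  next
    case False
    then show ?thesis
      using A by (simp add: binary_sequences_def autocorrelation_def)
  qed
  have "sum ?E (binary_sequences (Suc n)) =
      2 * cosh u ^ (Suc n - k - (n - k)) * sum ?E (binary_sequences n)"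
    unfolding sum_binary_sequences_Suc sum_distrib_left
    by (rule sum.cong) (simp_all only: step)
  also have "\<dots> = 2 ^ Suc n * (cosh u ^ (Suc n - k - (n - k)) * cosh u ^ (n - k))"
    by (simp add: Suc.IH)
  also have "cosh u ^ (Suc n - k - (n - k)) * cosh u ^ (n - k) = cosh u ^ (Suc n - k)"
    unfolding power_add [symmetric] by (rule arg_cong[where f = "power (cosh u)"]) simp
  finally show ?case .
qed

section \<open>Gaussian tails\<close>

lemma tanh_le_self:
  fixes x :: real
  assumes "0 \<le> x"
  shows "tanh x \<le> x"
proof -
  have "0 - tanh 0 \<le> x - tanh x"
  proof (rule DERIV_nonneg_imp_nondecreasing[OF assms])
    fix y :: real
    show "\<exists>D. ((\<lambda>x. x - tanh x) has_real_derivative D) (at y) \<and> 0 \<le> D"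
      by (rule exI[of _ "tanh y ^ 2"]) (auto intro!: derivative_eq_intros)
  qed
  then show ?thesis by simp
qed

lemma cosh_le_exp_half_square:
  fixes x :: real
  shows "cosh x \<le> exp (x\<^sup>2 / 2)"
proof -
  have *: "cosh y \<le> exp (y\<^sup>2 / 2)" if "0 \<le> y" for y :: real
  proof -
    have "0\<^sup>2 / 2 - ln (cosh 0) \<le> y\<^sup>2 / 2 - ln (cosh y)"
    proof (rule DERIV_nonneg_imp_nondecreasing[OF that])
      fix z :: real assume "0 \<le> z"
      then show "\<exists>D. ((\<lambda>z. z\<^sup>2 / 2 - ln (cosh z)) has_real_derivative D) (at z) \<and> 0 \<le> D"
        using tanh_le_self[of z]
        by (intro exI[of _ "z - tanh z"])
           (auto intro!: derivative_eq_intros simp: tanh_def field_simps)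
    qed
    then have "ln (cosh y) \<le> y\<^sup>2 / 2" by simp
    then have "exp (ln (cosh y)) \<le> exp (y\<^sup>2 / 2)" by (simp only: exp_le_cancel_iff)
    then show ?thesis by (simp add: cosh_real_pos)
  qed
  from *[of "\<bar>x\<bar>"] show ?thesis by simp
qed

text \<open>
  This is Markov's inequality for \<open>exp (u * s * c\<^sub>k)\<close>.  The parameter \<open>u = t / (n - k)\<close>
  minimises the exponent \<open>u\<^sup>2 * (n - k) / 2 - u * t\<close> of the resulting bound.
\<close>

lemma card_autocorrelation_gt:
  fixes t s :: real
  assumes "1 \<le> k" "k < n" "0 \<le> t" "s\<^sup>2 = 1"
  shows "real (card {A \<in> binary_sequences n. s * real_of_int (autocorrelation A k) > t})
           \<le> 2 ^ n * exp (- t\<^sup>2 / (2 * real (n - k)))"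
proof -
  define m where "m = real (n - k)"
  have m: "m > 0" using assms by (simp add: m_def)
  define u where "u = t / m"
  let ?S = "{A \<in> binary_sequences n. s * real_of_int (autocorrelation A k) > t}"
  have "real (card ?S) * exp (u * t) = (\<Sum>A\<in>?S. exp (u * t))"
    by simp
  also have "\<dots> \<le> (\<Sum>A\<in>?S. exp (u * s * real_of_int (autocorrelation A k)))"
  proof (rule sum_mono)
    fix A assume "A \<in> ?S"
    then have "u * t \<le> u * (s * real_of_int (autocorrelation A k))"
      using assms m by (intro mult_left_mono) (auto simp: u_def)
    then show "exp (u * t) \<le> exp (u * s * real_of_int (autocorrelation A k))"
      by (simp add: mult.assoc)
  qed
  also have "\<dots> \<le> (\<Sum>A\<in>binary_sequences n. exp (u * s * real_of_int (autocorrelation A k)))"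
    by (rule sum_mono2) (auto simp: finite_binary_sequences)
  also have "\<dots> = 2 ^ n * cosh (u * s) ^ (n - k)"
    by (rule sum_exp_autocorrelation[OF assms(1)])
  also have "\<dots> \<le> 2 ^ n * exp ((u * s)\<^sup>2 / 2) ^ (n - k)"
    by (intro mult_left_mono power_mono cosh_le_exp_half_square) auto
  also have "exp ((u * s)\<^sup>2 / 2) ^ (n - k) = exp (m * (u\<^sup>2 / 2))"
    using assms(4) by (simp add: power_mult_distrib m_def flip: exp_of_nat_mult)
  finally have "real (card ?S) \<le> 2 ^ n * (exp (m * (u\<^sup>2 / 2)) / exp (u * t))"
    by (simp add: field_simps)
  also have "exp (m * (u\<^sup>2 / 2)) / exp (u * t) = exp (m * (u\<^sup>2 / 2) - u * t)"
    by (simp add: exp_diff)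
  also have "m * (u\<^sup>2 / 2) - u * t = - t\<^sup>2 / (2 * m)"
    using m by (simp add: u_def power2_eq_square field_simps)
  finally show ?thesis
    by (simp add: m_def)
qed

lemma proportion_abs_autocorrelation_gt:
  fixes t :: real
  assumes "1 \<le> k" "k < n" "0 \<le> t"
  shows "proportion n (\<lambda>A. \<bar>real_of_int (autocorrelation A k)\<bar> > t)
           \<le> 2 * exp (- t\<^sup>2 / (2 * real (n - k)))"
proof -
  let ?S = "\<lambda>s. {A \<in> binary_sequences n. s * real_of_int (autocorrelation A k) > t}"
  have "{A \<in> binary_sequences n. \<bar>real_of_int (autocorrelation A k)\<bar> > t} = ?S 1 \<union> ?S (-1)"
    by auto
  then have "card {A \<in> binary_sequences n. \<bar>real_of_int (autocorrelation A k)\<bar> > t}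
      \<le> card (?S 1) + card (?S (-1))"
    using card_Un_le[of "?S 1" "?S (-1)"] by simp
  then have "real (card {A \<in> binary_sequences n. \<bar>real_of_int (autocorrelation A k)\<bar> > t})
      \<le> real (card (?S 1)) + real (card (?S (-1)))"
    by linarith
  also have "\<dots> \<le> 2 ^ n * exp (- t\<^sup>2 / (2 * real (n - k))) + 2 ^ n * exp (- t\<^sup>2 / (2 * real (n - k)))"
    by (intro add_mono card_autocorrelation_gt assms) auto
  finally show ?thesis
    by (simp add: proportion_def field_simps)
qed

section \<open>The union bound over all shifts\<close>

lemma proportion_peak_sidelobe_level_le_sum:
  assumes "2 \<le> n"
  shows "proportion n (\<lambda>A. real_of_int (peak_sidelobe_level A) > t)
           \<le> (\<Sum>k=1..n-1. proportion n (\<lambda>A. \<bar>real_of_int (autocorrelation A k)\<bar> > t))"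
proof -
  let ?S = "\<lambda>k. {A \<in> binary_sequences n. \<bar>real_of_int (autocorrelation A k)\<bar> > t}"
  have "{A \<in> binary_sequences n. real_of_int (peak_sidelobe_level A) > t}
      \<subseteq> (\<Union>k\<in>{1..n-1}. ?S k)"
  proof
    fix A assume A: "A \<in> {A \<in> binary_sequences n. real_of_int (peak_sidelobe_level A) > t}"
    then have "length A = n"
      by (simp add: binary_sequences_def)
    then have "peak_sidelobe_level A \<in> (\<lambda>k. \<bar>autocorrelation A k\<bar>) ` {1..n-1}"
      using assms Max_in[of "(\<lambda>k. \<bar>autocorrelation A k\<bar>) ` {1..n-1}"]
      by (simp add: peak_sidelobe_level_def)
    with A show "A \<in> (\<Union>k\<in>{1..n-1}. ?S k)"
      by auto
  qed
  then have "card {A \<in> binary_sequences n. real_of_int (peak_sidelobe_level A) > t}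
      \<le> card (\<Union>k\<in>{1..n-1}. ?S k)"
    by (intro card_mono) (auto simp: finite_binary_sequences)
  also have "\<dots> \<le> (\<Sum>k=1..n-1. card (?S k))"
    by (rule card_UN_le) simp
  finally have "real (card {A \<in> binary_sequences n. real_of_int (peak_sidelobe_level A) > t})
      \<le> (\<Sum>k=1..n-1. real (card (?S k)))"
    by (simp flip: of_nat_sum)
  then show ?thesis
    unfolding proportion_def by (simp add: divide_right_mono flip: sum_divide_distrib)
qed

lemma sum_exp_neg_mult_le:
  fixes x :: real
  assumes "x > 0"
  shows "(\<Sum>k=1..N. exp (- (real k * x))) \<le> 1 / x"
proof -
  \<comment> \<open>Unlike \<open>x\<close> itself, the factor \<open>exp x - 1 \<ge> x\<close> makes the sum telescope.\<close>
  have "(\<Sum>k=1..N. exp (- (real k * x))) * x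
      \<le> (\<Sum>k=1..N. exp (- (real k * x))) * (exp x - 1)"
    using exp_ge_add_one_self[of x]
    by (intro mult_left_mono sum_nonneg) (auto simp: algebra_simps simp del: exp_ge_add_one_self)
  also have "\<dots> = 1 - exp (- (real N * x))"
  proof (induction N)
    case (Suc N)
    have "exp (- (real (Suc N) * x)) * (exp x - 1) =
        exp (- (real N * x)) - exp (- (real (Suc N) * x))"
      by (simp add: right_diff_distrib algebra_simps flip: exp_add)
    with Suc.IH show ?case
      by (simp add: distrib_right)
  qed simp
  also have "\<dots> \<le> 1"
    by simp
  finally show ?thesis
    using assms by (simp add: field_simps)
qed

text \<open>
  The factor \<open>1 / L\<close> is gained because at shift \<open>k\<close> only \<open>n - k\<close> terms are summed, so that
  the tails decay geometrically in \<open>k\<close> with ratio \<open>exp (- L / n)\<close>.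
\<close>

lemma proportion_peak_sidelobe_level:
  fixes L :: real
  assumes n: "2 \<le> n" and L: "L > 0"
  shows "proportion n (\<lambda>A. real_of_int (peak_sidelobe_level A) > sqrt (2 * real n * L))
           \<le> 2 * exp (- L) * real n / L"
proof -
  let ?t = "sqrt (2 * real n * L)"
  have tail: "proportion n (\<lambda>A. \<bar>real_of_int (autocorrelation A k)\<bar> > ?t)
      \<le> 2 * exp (- L) * exp (- (real k * (L / real n)))" if k: "k \<in> {1..n-1}" for k
  proof -
    have kn: "1 \<le> k" "k < n" using k n by auto
    then have pos: "0 < real n" "0 < real n - real k" by auto
    have "(real n + real k) * (real n - real k) \<le> real n * real n"
      by (simp add: algebra_simps)
    then have "(real n + real k) / real n \<le> real n / (real n - real k)"
      using pos by (simp only: pos_le_divide_eq pos_divide_le_eq times_divide_eq_left)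
    then have "L * ((real n + real k) / real n) \<le> L * (real n / (real n - real k))"
      using L by (intro mult_left_mono) auto
    moreover have "?t\<^sup>2 / (2 * real (n - k)) = L * (real n / (real n - real k))"
      using L pos kn by (simp add: of_nat_diff divide_simps)
    moreover have "L * ((real n + real k) / real n) = L + real k * (L / real n)"
      using pos by (simp add: field_simps)
    ultimately have "- ?t\<^sup>2 / (2 * real (n - k)) \<le> - L + - (real k * (L / real n))"
      by simp
    then have "exp (- ?t\<^sup>2 / (2 * real (n - k))) \<le> exp (- L) * exp (- (real k * (L / real n)))"
      by (simp only: exp_le_cancel_iff flip: exp_add)
    moreover have "0 \<le> ?t" using L by simp
    ultimately show ?thesis
      using proportion_abs_autocorrelation_gt[OF kn, of ?t] by simp
  qed
  have "proportion n (\<lambda>A. real_of_int (peak_sidelobe_level A) > ?t)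
      \<le> (\<Sum>k=1..n-1. 2 * exp (- L) * exp (- (real k * (L / real n))))"
    by (rule order_trans[OF proportion_peak_sidelobe_level_le_sum[OF n]], rule sum_mono, rule tail)
  also have "\<dots> = 2 * exp (- L) * (\<Sum>k=1..n-1. exp (- (real k * (L / real n))))"
    by (simp add: sum_distrib_left)
  also have "\<dots> \<le> 2 * exp (- L) * (1 / (L / real n))"
    using L n by (intro mult_left_mono sum_exp_neg_mult_le) auto
  finally show ?thesis
    by simp
qed

theorem corollary2:
  fixes \<epsilon> :: real
  assumes "\<epsilon> > 0"
  shows "(\<lambda>n. proportion n (\<lambda>A. real_of_int (peak_sidelobe_level A) >
            sqrt (2 * real n * (ln (real n) - (1 - \<epsilon>) * ln (ln (real n))))))
          \<longlonglongrightarrow> 0"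
proof -
  define L where "L n = ln (real n) - (1 - \<epsilon>) * ln (ln (real n))" for n :: nat
  have L_pos: "\<forall>\<^sub>F n in sequentially. L n > 0"
    unfolding L_def by real_asymp
  have bound: "\<forall>\<^sub>F n in sequentially.
      proportion n (\<lambda>A. real_of_int (peak_sidelobe_level A) > sqrt (2 * real n * L n))
        \<le> 2 * exp (- L n) * real n / L n"
    using L_pos eventually_ge_at_top[of 2]
    by eventually_elim (rule proportion_peak_sidelobe_level)
  have limit: "(\<lambda>n. 2 * exp (- L n) * real n / L n) \<longlonglongrightarrow> 0"
    unfolding L_def using assms by real_asymp
  have "(\<lambda>n. proportion n (\<lambda>A. real_of_int (peak_sidelobe_level A) > sqrt (2 * real n * L n)))
      \<longlonglongrightarrow> 0"
    by (rule tendsto_sandwich[OF _ bound tendsto_const limit]) (simp add: proportion_def)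
  then show ?thesis
    by (simp only: L_def)
qed

end
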